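(* Let $p$ be a prime and $j\ge 0$ an integer. There is at most one polynomial $P_j$ (with complex coefficients) in the variables $X_w$, where $w\in W$, such that $$\frac{\vartheta_p(j,n)}{\vartheta_p(0,n)}=P_j\bigl((|n|_w)_{w\in W}\bigr)$$ for all integers $n\ge 0$.
   Context: Digits are elements of $\{0,\ldots,p-1\}$. Words are written $w=w_{\mu-1}\cdots w_0$ with $w_{\mu-1}$ leftmost. For a nonnegative integer $n$ with base-$p$ expansion $n=\sum_{i\ge 0}n_ip^i$ (padded with infinitely many zero digits) and a word $w$ of length $\mu$ containing a nonzero digit, $|n|_w=|\{i\ge 0: n_{i+\mu-1}\cdots n_i=w_{\mu-1}\cdots w_0\}|$ is the number of (possibly overlapping) occurrences of $w$ in the expansion of $n$. For $j,n\ge 0$, $\vartheta_p(j,n)=|\{t\in\{0,\ldots,n\}:\nu_p\binom nt=j\}|$, where $\nu_p(m)$ is the exponent of $p$ in $m$. $W$ is the (infinite) set of all words $w_{\mu-1}\cdots w_0$ over $\{0,\ldots,p-1\}$ with $\mu\ge 2$, $w_{\mu-1}\ne 0$ and $w_0\ne p-1$. A polynomial in the variables $X_w$, $w\in W$, involves only finitely many of them. *)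

theory Defs
  imports Complex_Main "HOL-Computational_Algebra.Primes" "HOL-Library.Poly_Mapping"
begin

(* A word w_{mu-1} ... w_0 is the list [w_{mu-1}, ..., w_0], in reading order:
   hd is the leftmost letter w_{mu-1} and last is the rightmost letter w_0. *)

definition base_digit :: "nat \<Rightarrow> nat \<Rightarrow> nat \<Rightarrow> nat" where
  "base_digit p n i = n div p ^ i mod p"

(* |n|_w, for p >= 2 and w containing a nonzero digit (as all words in W below do): then the
   set is finite and card is the intended count.  rev [0..<mu] lists the offsets
   mu-1, ..., 0. *)
definition word_count :: "nat \<Rightarrow> nat list \<Rightarrow> nat \<Rightarrow> nat" where
  "word_count p w n = card {i. map (\<lambda>k. base_digit p n (i + k)) (rev [0..<length w]) = w}"

definition binom_val_count :: "nat \<Rightarrow> nat \<Rightarrow> nat \<Rightarrow> nat" where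
  "binom_val_count p j n = card {t \<in> {0..n}. multiplicity p (n choose t) = j}"

definition admissible_words :: "nat \<Rightarrow> nat list set" where
  "admissible_words p =
     {w. set w \<subseteq> {..<p} \<and> length w \<ge> 2 \<and> hd w \<noteq> 0 \<and> last w \<noteq> p - 1}"

(* Polynomials with coefficients in 'a and variables indexed by 'x: a monomial is a finitely
   supported exponent function, and a polynomial a finitely supported coefficient function
   on monomials. *)
type_synonym ('x, 'a) mvpoly = "('x \<Rightarrow>\<^sub>0 nat) \<Rightarrow>\<^sub>0 'a"

definition mvpoly_vars :: "('x, 'a::zero) mvpoly \<Rightarrow> 'x set" where
  "mvpoly_vars P = (\<Union>m \<in> Poly_Mapping.keys P. Poly_Mapping.keys m)"

definition mvpoly_eval :: "('x \<Rightarrow> 'a) \<Rightarrow> ('x, 'a::comm_semiring_1) mvpoly \<Rightarrow> 'a" where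
  "mvpoly_eval a P =
     (\<Sum>m \<in> Poly_Mapping.keys P. Poly_Mapping.lookup P m *
        (\<Prod>x \<in> Poly_Mapping.keys m. a x ^ Poly_Mapping.lookup m x))"

end

(* It suffices that the functions n -> |n|_w, w in W, are algebraically independent.  Fix a finite
   set of words of length at most M and let n be a concatenation of blocks 0^M b (p-1)^M.  As w
   neither starts with 0 nor ends with p-1, an occurrence of w lies inside some b or inside a
   pattern (p-1)^M 0^M, so |n|_w is the sum of the occurrences in the b's plus a constant times the
   number of blocks.  Padding with empty blocks keeps that number fixed.  Exchanging empty blocks
   for copies of a shortest word v then moves the count of v through arbitrarily many values and
   no other count, so the coefficients with respect to X_v vanish and v can be eliminated. *)
theory Submission
  imports Defs "HOL-Computational_Algebra.Polynomial" "HOL-Library.Sublist"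
begin

section \<open>Algebraic independence of additive counts\<close>

text \<open>These sums are the coefficients of one polynomial of degree at most \<open>D\<close>
  with more than \<open>D\<close> roots. As \<open>m\<close> may repeat exponents, the
  \<open>d k\<close> are grouped by exponent.\<close>

lemma coeff_sums_eq_0_if_many_roots:
  fixes d :: "'k \<Rightarrow> 'a::idom"
  assumes "finite K" and deg: "\<And>k. k \<in> K \<Longrightarrow> m k \<le> D"
    and roots: "finite R" "card R > D" "\<And>t. t \<in> R \<Longrightarrow> (\<Sum>k\<in>K. d k * t ^ m k) = 0"
  shows "(\<Sum>k | k \<in> K \<and> m k = i. d k) = 0"
proof -
  define q where "q = (\<Sum>k\<in>K. monom (d k) (m k))"
  have "degree q \<le> D"
    unfolding q_def using deg by (intro degree_sum_le assms(1)) (meson degree_monom_le order_trans)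
  moreover have R: "R \<subseteq> {t. poly q t = 0}"
    using roots(3) by (auto simp: q_def poly_sum poly_monom)
  have "card R \<le> degree q" if "q \<noteq> 0"
    using card_mono[OF poly_roots_finite[OF that] R] card_poly_roots_bound[OF that] by linarith
  ultimately have "q = 0"
    using roots(2) by fastforce
  then have "coeff q i = 0" by simp
  then show ?thesis
    using assms(1) by (simp add: q_def coeff_sum sum.If_cases Int_def)
qed

text \<open>\<open>K\<close> indexes monomials with exponent vectors \<open>e k\<close>;
  \<open>f b x\<close> is the gain of count \<open>x\<close> inside block \<open>b\<close>,
  \<open>C x\<close> its gain per block, \<open>z\<close> an empty block. The offset
  \<open>N\<close> records the padding blocks already spent on eliminated variables, so that the
  induction can proceed.\<close>

lemma triangular_additive_counts_independent:
  fixes f :: "'b \<Rightarrow> 'x \<Rightarrow> nat" and C :: "'x \<Rightarrow> nat" and size :: "'x \<Rightarrow> nat"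
    and c :: "'k \<Rightarrow> 'a::{idom, ring_char_0}"
  assumes "finite F"
    and z: "\<And>x. x \<in> F \<Longrightarrow> f z x = 0"
    and diag: "\<And>x. x \<in> F \<Longrightarrow> f (\<beta> x) x \<noteq> 0"
    and tri: "\<And>x y. x \<in> F \<Longrightarrow> y \<in> F \<Longrightarrow> x \<noteq> y \<Longrightarrow> size x \<le> size y \<Longrightarrow> f (\<beta> x) y = 0"
    and "finite K"
    and sep: "\<And>k l. k \<in> K \<Longrightarrow> l \<in> K \<Longrightarrow> (\<And>x. x \<in> F \<Longrightarrow> e k x = e l x) \<Longrightarrow> k = l"
    and zero: "\<And>bs. (\<Sum>k\<in>K. c k * (\<Prod>x\<in>F.
         of_nat (C x * (length bs + N) + (\<Sum>b\<leftarrow>bs. f b x)) ^ e k x)) = 0"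
    and "k \<in> K"
  shows "c k = 0"
  using assms
\<comment> \<open>Negating \<open>size\<close> makes each inserted \<open>v\<close> one of least
  size, so by \<open>tri\<close> its block \<open>\<beta> v\<close> adds nothing to the other
  counts.\<close>
proof (induction F arbitrary: K N k rule: finite_ranking_induct[where f = "\<lambda>x. - int (size x)"])
  case empty
  then have "K = {k}" by blast
  then show ?case using empty.prems(6) by simp
next
  case (insert v F)
  show ?case
  proof (cases "v \<in> F")
    case True
    show ?thesis
      by (rule insert.IH) (fact insert.prems[unfolded insert_absorb[OF True]])+
  next
    case False
    define D where "D = Max ((\<lambda>k. e k v) ` K)"
    define K' where "K' = {l \<in> K. e l v = e k v}"
    have vF: "f (\<beta> v) x = 0" if "x \<in> F" for x
      using insert.prems(3)[of v x] insert.hyps(2)[OF that] that False by auto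
    show ?thesis
    proof (rule insert.IH[where K = K' and N = "N + D" and k = k])
      fix bs
      let ?cnt = "\<lambda>bs x. C x * (length bs + N) + (\<Sum>b\<leftarrow>bs. f b x)"
      \<comment> \<open>For every \<open>j \<le> D\<close> exactly \<open>D\<close> blocks are
        appended, so only the count of \<open>v\<close> depends on \<open>j\<close>; it takes
        \<open>D + 1\<close> values because \<open>f (\<beta> v) v\<close> is nonzero.\<close>
      define as where "as j = bs @ replicate j (\<beta> v) @ replicate (D - j) z" for j
      define d where "d l = c l * (\<Prod>x\<in>F.
         of_nat (C x * (length bs + (N + D)) + (\<Sum>b\<leftarrow>bs. f b x)) ^ e l x)" for l
      have cntF: "?cnt (as j) x = C x * (length bs + (N + D)) + (\<Sum>b\<leftarrow>bs. f b x)"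
        if "x \<in> F" "j \<le> D" for x j
        using that vF insert.prems(1)[of x] by (simp add: as_def sum_list_replicate algebra_simps)
      have cntv: "?cnt (as j) v = C v * (length bs + (N + D)) + (\<Sum>b\<leftarrow>bs. f b v) + j * f (\<beta> v) v"
        if "j \<le> D" for j
        using that insert.prems(1)[of v] by (simp add: as_def sum_list_replicate algebra_simps)
      define R where "R = (\<lambda>j. of_nat (?cnt (as j) v) :: 'a) ` {..D}"
      have inj: "inj_on (\<lambda>j. of_nat (?cnt (as j) v) :: 'a) {..D}"
      proof (rule inj_onI)
        fix i j assume "i \<in> {..D}" "j \<in> {..D}"
          and "(of_nat (?cnt (as i) v) :: 'a) = of_nat (?cnt (as j) v)"
        then show "i = j" using insert.prems(2)[of v] cntv[of i] cntv[of j]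
          by (simp only: of_nat_eq_iff atMost_iff) simp
      qed
      \<comment> \<open>As a polynomial in the count of \<open>v\<close> the relation has degree at
        most \<open>D\<close>; its coefficient at exponent \<open>e k v\<close> is the relation over
        \<open>K'\<close> in the remaining variables.\<close>
      have "(\<Sum>l | l \<in> K \<and> e l v = e k v. d l) = 0"
      proof (rule coeff_sums_eq_0_if_many_roots[where R = R])
        show "finite K" by fact
        show "e l v \<le> D" if "l \<in> K" for l
          using that \<open>finite K\<close> by (simp add: D_def)
        show "finite R" by (simp add: R_def)
        show "D < card R" unfolding R_def using card_image[OF inj] by simp
        fix t assume "t \<in> R"
        then obtain j where j: "j \<le> D" "t = of_nat (?cnt (as j) v)" by (auto simp: R_def)
        have "(\<Sum>l\<in>K. d l * t ^ e l v) =
            (\<Sum>l\<in>K. c l * (\<Prod>x\<in>insert v F. of_nat (?cnt (as j) x) ^ e l x))"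
        proof (rule sum.cong[OF refl])
          fix l
          have "(\<Prod>x\<in>F. (of_nat (?cnt (as j) x) :: 'a) ^ e l x) = (\<Prod>x\<in>F.
              of_nat (C x * (length bs + (N + D)) + (\<Sum>b\<leftarrow>bs. f b x)) ^ e l x)"
            by (rule prod.cong[OF refl]) (simp only: cntF j)
          then show "d l * t ^ e l v = c l * (\<Prod>x\<in>insert v F. of_nat (?cnt (as j) x) ^ e l x)"
            unfolding prod.insert[OF \<open>finite F\<close> False] d_def j(2) by (simp only: mult_ac)
        qed
        then show "(\<Sum>l\<in>K. d l * t ^ e l v) = 0"
          using insert.prems(6)[of "as j"] by simp
      qed
      then show "(\<Sum>l\<in>K'. c l * (\<Prod>x\<in>F.
         of_nat (C x * (length bs + (N + D)) + (\<Sum>b\<leftarrow>bs. f b x)) ^ e l x)) = 0"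
        by (simp add: K'_def d_def)
    next
      fix l l' assume "l \<in> K'" "l' \<in> K'" "\<And>x. x \<in> F \<Longrightarrow> e l x = e l' x"
      then show "l = l'" by (intro insert.prems(5)) (auto simp: K'_def)
    qed (use insert.prems in \<open>auto simp: K'_def\<close>)
  qed
qed

section \<open>Occurrences of a word in a list\<close>

fun list_occs :: "'a list \<Rightarrow> 'a list \<Rightarrow> nat" where
  "list_occs u [] = 0"
| "list_occs u (x # xs) = (if prefix u (x # xs) then 1 else 0) + list_occs u xs"

text \<open>The word does not fit, or fills the whole list and differs from it. This is the source
  of triangularity with respect to word length.\<close>

lemma list_occs_eq_0:
  assumes "length xs \<le> length u" "xs \<noteq> u"
  shows "list_occs u xs = 0"
proof -
  have short: "list_occs u ys = 0" if "length ys < length u" for ys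
    using that by (induction ys) (auto dest: prefix_length_le)
  show ?thesis
  proof (cases xs)
    case (Cons y ys)
    have "\<not> prefix u xs"
      using assms by (metis append_eq_conv_conj prefixE prefix_length_le le_antisym take_all_iff)
    then show ?thesis using assms short[of ys] by (simp add: Cons)
  qed simp
qed

lemma list_occs_self: "u \<noteq> [] \<Longrightarrow> list_occs u u = 1"
  by (cases u) (auto simp: list_occs_eq_0)

text \<open>An occurrence starting in the added run would begin with \<open>a\<close>.\<close>

lemma list_occs_replicate_append:
  assumes "u \<noteq> []" "hd u \<noteq> a"
  shows "list_occs u (replicate k a @ ys) = list_occs u ys"
  using assms by (induction k) (auto simp: prefix_Cons)

text \<open>An occurrence reaching into the added run would end with \<open>a\<close>.\<close>

lemma list_occs_append_replicate:
  assumes "u \<noteq> []" "last u \<noteq> a"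
  shows "list_occs u (xs @ replicate k a) = list_occs u xs"
proof (induction xs)
  case Nil
  have "list_occs u (replicate k a) = 0"
  proof (induction k)
    case (Suc k)
    have "\<not> prefix u (replicate (Suc k) a)"
      using assms by (metis in_set_replicate last_in_set set_mono_prefix subsetD)
    then show ?case using Suc by simp
  qed simp
  then show ?case by simp
next
  case (Cons x xs)
  have "prefix u (x # xs @ replicate k a) \<longleftrightarrow> prefix u (x # xs)"
  proof
    assume "prefix u (x # xs @ replicate k a)"
    then have "prefix u ((x # xs) @ replicate k a)" by simp
    then consider "prefix u (x # xs)" | us where "u = (x # xs) @ us" "prefix us (replicate k a)"
      unfolding prefix_append by blast
    then show "prefix u (x # xs)"
    proof cases
      case 2
      then have "us = []"
        using assms by (metis in_set_replicate last_appendR last_in_set set_mono_prefix subsetD)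
      then show ?thesis using 2 by simp
    qed
  qed (metis append_Cons prefix_append)
  then show ?case using Cons by simp
qed

text \<open>Inclusion-exclusion: \<open>s\<close> is too long for an occurrence to bridge it
  strictly, so each one lies in \<open>xs @ s\<close> or in \<open>s @ ys\<close>, and in both when
  it lies in \<open>s\<close>.\<close>

lemma list_occs_append_overlap:
  assumes "length u \<le> length s"
  shows "list_occs u (xs @ s @ ys) + list_occs u s = list_occs u (xs @ s) + list_occs u (s @ ys)"
proof (induction xs)
  case (Cons x xs)
  have "prefix u ((x # xs @ s) @ ys) \<longleftrightarrow> prefix u (x # xs @ s)"
    using assms unfolding prefix_append by auto
  then show ?case using Cons by simp
qed simp

section \<open>Digit lists built from blocks\<close>

text \<open>Digit lists start with the least significant digit, so words appear reversed in them.\<close>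

definition block_digits :: "nat \<Rightarrow> nat \<Rightarrow> nat list list \<Rightarrow> nat list" where
  "block_digits p M bs = replicate M (p - 1) @
     concat (map (\<lambda>b. b @ replicate M 0 @ replicate M (p - 1)) bs)"

text \<open>No occurrence starts in the run of \<open>p - 1\<close> before a block and enters it, or
  ends in the zeros after it. The rest lie in blocks or in junctions of zeros with
  \<open>p - 1\<close>; the closing run gives each block, even the last, one junction.\<close>

lemma list_occs_block_digits:
  assumes u: "u \<noteq> []" "hd u \<noteq> p - 1" "last u \<noteq> 0" "length u \<le> M"
  shows "list_occs u (block_digits p M bs) =
    list_occs u (replicate M 0 @ replicate M (p - 1)) * length bs + (\<Sum>b\<leftarrow>bs. list_occs u b)"
proof (induction bs)
  case Nil
  show ?case
    using list_occs_replicate_append[of u "p - 1" M "[]"] u by (simp add: block_digits_def)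
next
  case (Cons b bs)
  let ?Z = "replicate M (0::nat)" and ?H = "replicate M (p - 1)"
  let ?t = "concat (map (\<lambda>b. b @ ?Z @ ?H) bs)"
  have H: "list_occs u ?H = 0"
    using list_occs_replicate_append[of u "p - 1" M "[]"] u by simp
  have Z: "list_occs u ?Z = 0"
    using list_occs_append_replicate[of u 0 "[]" M] u by simp
  have "list_occs u (block_digits p M (b # bs)) = list_occs u (b @ ?Z @ ?H @ ?t)"
    using u by (simp add: block_digits_def list_occs_replicate_append)
  \<comment> \<open>The runs \<open>?Z\<close> and \<open>?H\<close> contain no \<open>u\<close>, so
    cutting at either makes the count additive.\<close>
  also have "\<dots> = list_occs u b + list_occs u (?Z @ ?H @ ?t)"
    using list_occs_append_overlap[of u ?Z b "?H @ ?t"] u Z by (simp add: list_occs_append_replicate)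
  also have "list_occs u (?Z @ ?H @ ?t) = list_occs u (?Z @ ?H) + list_occs u (block_digits p M bs)"
    using list_occs_append_overlap[of u ?H ?Z ?t] u H by (simp add: block_digits_def)
  finally show ?case using Cons by simp
qed

section \<open>Word counts of numbers given by digit lists\<close>

lemma base_digit_0: "x < p \<Longrightarrow> base_digit p (x + p * m) 0 = x"
  by (simp add: base_digit_def)

lemma base_digit_Suc: "x < p \<Longrightarrow> base_digit p (x + p * m) (Suc i) = base_digit p m i"
  by (simp add: base_digit_def div_mult2_eq)

lemma base_digit_horner_sum:
  assumes "set ds \<subseteq> {..<p}"
  shows "base_digit p (horner_sum id p ds) i = (if i < length ds then ds ! i else 0)"
  using assms
proof (induction ds arbitrary: i)
  case (Cons d ds)
  then show ?case by (cases i) (auto simp: base_digit_0 base_digit_Suc)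
qed (simp add: base_digit_def)

lemma word_match_iff:
  "map (\<lambda>k. g (i + k)) (rev [0..<length w]) = w \<longleftrightarrow> (\<forall>k<length w. g (i + k) = rev w ! k)"
proof -
  have "map (\<lambda>k. g (i + k)) (rev [0..<length w]) = w \<longleftrightarrow> map (\<lambda>k. g (i + k)) [0..<length w] = rev w"
    unfolding rev_map[symmetric] by (rule rev_swap)
  also have "\<dots> \<longleftrightarrow> (\<forall>k<length w. g (i + k) = rev w ! k)"
    unfolding list_eq_iff_nth_eq[of "map _ _" "rev w"] by simp
  finally show ?thesis .
qed

text \<open>The leading letter of \<open>w\<close> is nonzero, so no occurrence reaches the infinite
  zero padding, and the finite digit list suffices.\<close>

lemma word_count_horner_sum:
  assumes "set ds \<subseteq> {..<p}" "w \<noteq> []" "hd w \<noteq> 0"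
  shows "word_count p w (horner_sum id p ds) = list_occs (rev w) ds"
proof -
  \<comment> \<open>Match positions in the zero-padded list, for arbitrary lists to allow induction
    on \<open>ds\<close>.\<close>
  define A where "A ds = {i. \<forall>k<length w. (if i + k < length ds then ds ! (i + k) else 0) = rev w ! k}"
    for ds :: "nat list"
  have last: "rev w ! (length w - 1) \<noteq> 0"
    using assms by (simp add: rev_nth hd_conv_nth)
  have bound: "i + length w \<le> length ds" if "i \<in> A ds" for i ds
  proof (rule ccontr)
    assume "\<not> i + length w \<le> length ds"
    then have "\<not> i + (length w - 1) < length ds" by linarith
    then have "\<not> (\<forall>k<length w. (if i + k < length ds then ds ! (i + k) else 0) = rev w ! k)"
      using last assms(2) by (intro notI) (drule spec[of _ "length w - 1"], simp)
    then show False using that unfolding A_def mem_Collect_eq by contradiction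
  qed
  then have fin: "finite (A ds)" for ds
    by (meson add_leD1 finite_nat_set_iff_bounded_le)
  have "word_count p w (horner_sum id p ds) = card (A ds)"
    unfolding word_count_def A_def word_match_iff[where g = "base_digit p (horner_sum id p ds)"]
    by (simp only: base_digit_horner_sum[OF assms(1)])
  also have "\<dots> = list_occs (rev w) ds"
  proof (induction ds)
    case Nil
    have "A [] = {}" using bound[of _ "[]"] assms(2) by auto
    then show ?case by simp
  next
    case (Cons d ds)
    have split: "A (d # ds) = (if 0 \<in> A (d # ds) then {0} else {}) \<union> Suc ` A ds"
    proof (rule set_eqI)
      fix i show "i \<in> A (d # ds) \<longleftrightarrow> i \<in> (if 0 \<in> A (d # ds) then {0} else {}) \<union> Suc ` A ds"
        by (cases i) (auto simp: A_def)
    qed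
    have "0 \<in> A (d # ds) \<longleftrightarrow> prefix (rev w) (d # ds)"
    proof
      assume *: "0 \<in> A (d # ds)"
      then have "take (length w) (d # ds) = rev w"
        using bound[OF *] by (intro nth_equalityI) (auto simp: A_def split: if_splits)
      then show "prefix (rev w) (d # ds)" using take_is_prefix[of "length w" "d # ds"] by argo
    next
      assume "prefix (rev w) (d # ds)"
      then obtain zs where "d # ds = rev w @ zs" by (auto simp: prefix_def)
      then show "0 \<in> A (d # ds)" by (auto simp: A_def nth_append)
    qed
    moreover have "card (A (d # ds)) = (if 0 \<in> A (d # ds) then 1 else 0) + card (A ds)"
    proof -
      have "card (A (d # ds)) = card (if 0 \<in> A (d # ds) then {0::nat} else {}) + card (Suc ` A ds)"
        using fin by (subst split, intro card_Un_disjoint) auto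
      then show ?thesis by (simp add: card_image)
    qed
    ultimately show ?case using Cons by simp
  qed
  finally show ?thesis .
qed

section \<open>Algebraic independence of word counts\<close>

text \<open>Words are ranked by length. The block of \<open>v\<close> is \<open>rev v\<close>, which
  contains \<open>v\<close> but no other word that is at least as long.\<close>

lemma admissible_word_counts_independent:
  fixes c :: "'k \<Rightarrow> 'a::{idom, ring_char_0}"
  assumes p: "p > 0" and F: "finite F" "F \<subseteq> admissible_words p" and K: "finite K"
    and sep: "\<And>k l. k \<in> K \<Longrightarrow> l \<in> K \<Longrightarrow> (\<And>w. w \<in> F \<Longrightarrow> e k w = e l w) \<Longrightarrow> k = l"
    and zero: "\<And>n. (\<Sum>k\<in>K. c k * (\<Prod>w\<in>F. of_nat (word_count p w n) ^ e k w)) = 0"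
    and k: "k \<in> K"
  shows "c k = 0"
proof -
  define M where "M = Max (length ` F)"
  have M: "length w \<le> M" if "w \<in> F" for w
    using that F(1) by (simp add: M_def)
  have adm: "set w \<subseteq> {..<p}" "w \<noteq> []" "hd w \<noteq> 0" "last w \<noteq> p - 1" if "w \<in> F" for w
    using that F(2) by (auto simp: admissible_words_def)
  \<comment> \<open>Blocks with letters outside the digit range are replaced by the empty block.\<close>
  define \<phi> where "\<phi> b = (if set b \<subseteq> {..<p} then b else [])" for b
  show ?thesis
  proof (rule triangular_additive_counts_independent[where F = F and f = "\<lambda>b w. list_occs (rev w) (\<phi> b)"
        and z = "[]" and \<beta> = rev and size = length and K = K and e = e and N = 0
        and C = "\<lambda>w. list_occs (rev w) (replicate M 0 @ replicate M (p - 1))"])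
    show "list_occs (rev w) (\<phi> []) = 0" for w by (simp add: \<phi>_def)
    show "list_occs (rev w) (\<phi> (rev w)) \<noteq> 0" if "w \<in> F" for w
      using adm[OF that] by (simp add: \<phi>_def list_occs_self)
    show "list_occs (rev w) (\<phi> (rev v)) = 0"
      if "v \<in> F" "w \<in> F" "v \<noteq> w" "length v \<le> length w" for v w
      using that adm[OF that(1)] by (simp add: \<phi>_def list_occs_eq_0)
    fix bs
    \<comment> \<open>This single \<open>n\<close> realises all the prescribed counts at once, so
      \<open>zero\<close> at \<open>n\<close> is the required relation.\<close>
    define n where "n = horner_sum id p (block_digits p M (map \<phi> bs))"
    have "set (block_digits p M (map \<phi> bs)) \<subseteq> {..<p}"
      using p by (auto simp: block_digits_def \<phi>_def split: if_splits)
    then have "word_count p w n = list_occs (rev w) (replicate M 0 @ replicate M (p - 1)) *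
        (length bs + 0) + (\<Sum>b\<leftarrow>bs. list_occs (rev w) (\<phi> b))" if "w \<in> F" for w
      using adm[OF that] M[OF that] unfolding n_def
      by (simp add: word_count_horner_sum list_occs_block_digits hd_rev last_rev o_def)
    then have "(\<Sum>k\<in>K. c k * (\<Prod>w\<in>F. of_nat (list_occs (rev w) (replicate M 0 @ replicate M (p - 1)) *
        (length bs + 0) + (\<Sum>b\<leftarrow>bs. list_occs (rev w) (\<phi> b))) ^ e k w)) =
        (\<Sum>k\<in>K. c k * (\<Prod>w\<in>F. of_nat (word_count p w n) ^ e k w))"
      by (intro sum.cong prod.cong arg_cong2[where f = "(*)"] refl) simp
    then show "(\<Sum>k\<in>K. c k * (\<Prod>w\<in>F. of_nat (list_occs (rev w) (replicate M 0 @ replicate M (p - 1)) *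
        (length bs + 0) + (\<Sum>b\<leftarrow>bs. list_occs (rev w) (\<phi> b))) ^ e k w)) = 0"
      using zero by simp
  qed (use F K sep k in auto)
qed

section \<open>Uniqueness of the polynomial\<close>

text \<open>Extra monomials have coefficient 0 and extra variables exponent 0; this puts two
  polynomials over common index sets.\<close>

lemma mvpoly_eval_superset:
  assumes "finite K" "Poly_Mapping.keys P \<subseteq> K" "finite F" "mvpoly_vars P \<subseteq> F"
  shows "mvpoly_eval a P =
    (\<Sum>m\<in>K. Poly_Mapping.lookup P m * (\<Prod>x\<in>F. a x ^ Poly_Mapping.lookup m x))"
proof -
  have "(\<Prod>x\<in>Poly_Mapping.keys m. a x ^ Poly_Mapping.lookup m x) =
      (\<Prod>x\<in>F. a x ^ Poly_Mapping.lookup m x)" if "m \<in> Poly_Mapping.keys P" for m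
    using that assms(3,4)
    by (intro prod.mono_neutral_left) (auto simp: mvpoly_vars_def not_in_keys_iff_lookup_eq_zero)
  then have "mvpoly_eval a P = (\<Sum>m\<in>Poly_Mapping.keys P.
      Poly_Mapping.lookup P m * (\<Prod>x\<in>F. a x ^ Poly_Mapping.lookup m x))"
    by (simp add: mvpoly_eval_def)
  also have "\<dots> = (\<Sum>m\<in>K. Poly_Mapping.lookup P m * (\<Prod>x\<in>F. a x ^ Poly_Mapping.lookup m x))"
    using assms(1,2) by (intro sum.mono_neutral_left) (auto simp: in_keys_iff)
  finally show ?thesis .
qed

theorem proposition2p1:
  fixes p j :: nat
  assumes "prime p"
  shows "\<exists>\<^sub>\<le>\<^sub>1 P :: (nat list, complex) mvpoly.
           mvpoly_vars P \<subseteq> admissible_words p \<and>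
           (\<forall>n::nat. of_nat (binom_val_count p j n) / of_nat (binom_val_count p 0 n)
              = mvpoly_eval (\<lambda>w. of_nat (word_count p w n)) P)"
proof (rule Uniq_I, elim conjE)
  fix P Q :: "(nat list, complex) mvpoly"
  assume vars: "mvpoly_vars P \<subseteq> admissible_words p" "mvpoly_vars Q \<subseteq> admissible_words p"
    and vals: "\<forall>n::nat. of_nat (binom_val_count p j n) / of_nat (binom_val_count p 0 n)
        = mvpoly_eval (\<lambda>w. of_nat (word_count p w n)) P"
      "\<forall>n::nat. of_nat (binom_val_count p j n) / of_nat (binom_val_count p 0 n)
        = mvpoly_eval (\<lambda>w. of_nat (word_count p w n)) Q"
  define K where "K = Poly_Mapping.keys P \<union> Poly_Mapping.keys Q"
  define F where "F = mvpoly_vars P \<union> mvpoly_vars Q"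
  have fin: "finite K" "finite F" by (auto simp: K_def F_def mvpoly_vars_def)
  \<comment> \<open>Both polynomials take the same value at every \<open>n\<close>, so the
    coefficient differences form a relation among the counts.\<close>
  have "Poly_Mapping.lookup P m - Poly_Mapping.lookup Q m = 0" if "m \<in> K" for m
  proof (rule admissible_word_counts_independent[where F = F and K = K
        and e = Poly_Mapping.lookup and p = p])
    show "p > 0" using assms by (rule prime_gt_0_nat)
    show "F \<subseteq> admissible_words p" using vars by (simp add: F_def)
    fix m m' :: "nat list \<Rightarrow>\<^sub>0 nat"
    assume "m \<in> K" "m' \<in> K"
      and eq: "\<And>w. w \<in> F \<Longrightarrow> Poly_Mapping.lookup m w = Poly_Mapping.lookup m' w"
    then have "Poly_Mapping.keys m \<subseteq> F" "Poly_Mapping.keys m' \<subseteq> F"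
      by (auto simp: K_def F_def mvpoly_vars_def)
    then show "m = m'"
      using eq by (intro poly_mapping_eqI) (metis in_keys_iff subsetD)
  next
    fix n
    show "(\<Sum>m\<in>K. (Poly_Mapping.lookup P m - Poly_Mapping.lookup Q m) *
        (\<Prod>w\<in>F. of_nat (word_count p w n) ^ Poly_Mapping.lookup m w)) = 0"
      using vals mvpoly_eval_superset[OF fin(1) _ fin(2), of P] mvpoly_eval_superset[OF fin(1) _ fin(2), of Q]
      by (simp add: K_def F_def left_diff_distrib sum_subtractf)
  qed (use fin that in auto)
  \<comment> \<open>Outside \<open>K\<close> both coefficients are 0.\<close>
  then show "P = Q"
    by (intro poly_mapping_eqI) (metis K_def UnCI in_keys_iff right_minus_eq)
qed

end
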